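(* For any integers $n,k\ge 1$ one has, in $\mathbb Z[\tilde\Lambda]$, $$\Lambda_{n+1}^k\,B(n)=k\,B(n)\,\Lambda_n^k .$$
   Context: Epicyclic category. For $n\ge 0$ let $\underline n$ denote $\mathbb Z$ with its usual order and the automorphism $x\mapsto x+n+1$. The epicyclic category $\tilde\Lambda$ has the objects $\underline n$; $\mathrm{Hom}_{\tilde\Lambda}(\underline n,\underline m)$ is the set of equivalence classes of non-decreasing maps $f:\mathbb Z\to\mathbb Z$ for which there is an integer $k>0$ (the module of $f$) with $f(x+n+1)=f(x)+k(m+1)$ for all $x$, where $f\sim g$ iff $g=f+a(m+1)$ for some $a\in\mathbb Z$. The cyclic category $\Lambda\subset\tilde\Lambda$ has the same objects and the morphisms with $k=1$. $\mathbb Z[\tilde\Lambda]$ is the ring of finite formal integral combinations of morphisms of $\tilde\Lambda$, the product of two morphisms being their composite when composable and $0$ otherwise. The operator $B(n)$. $\mathrm{Aut}_\Lambda(\underline n)$ is cyclic of order $n+1$, generated by the class of $x\mapsto x-1$ (equivalently of $x\mapsto x+1$); each $\tau\in \mathrm{Aut}_\Lambda(\underline n)$ induces a permutation of $\mathbb Z/(n+1)\mathbb Z$, denoted $\mathrm{Perm}(\tau)$, with signature $\epsilon(\mathrm{Perm}(\tau))$. Put $A=\sum_{\tau\in\mathrm{Aut}_\Lambda(\underline n)}\epsilon(\mathrm{Perm}(\tau))\,\tau$, let $B_0\in\mathrm{Hom}_\Lambda(\underline n,\underline{n+1})$ be the class of the map $i+a(n+1)\mapsto 1+i+a(n+2)$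 ($0\le i\le n$, $a\in\mathbb Z$), and $B(n)=B_0A\in\mathbb Z[\Lambda]\subset\mathbb Z[\tilde\Lambda]$. The elements $\Lambda_n^k$. Let $n^*=\{0,\dots,n+1\}$, with interval morphisms the non-decreasing maps preserving the smallest and largest elements, and $\mathrm{Sd}_k^*(n^* )=\{0,\dots,k(n+1)\}$. Let $\Sigma_n^k$ be the set of interval morphisms $\alpha:n^*\to\{0,\dots,k(n+1)\}$ such that $j\mapsto \alpha(j)$ mod $(n+1)$ defines a permutation of $\{0,\dots,n\}$ (identified with $\mathbb Z/(n+1)\mathbb Z$); this permutation fixes $0$, and its restriction to $\{1,\dots,n\}$ is denoted $\mathrm{Perm}(\alpha)\in S_n$. For $\alpha\in\Sigma_n^k$ let $\tilde\alpha:\mathbb Z\to\mathbb Z$ be the map extending $\alpha$ with $\tilde\alpha(x+n+1)=\tilde\alpha(x)+k(n+1)$, viewed as an element of $\mathrm{Hom}_{\tilde\Lambda}(\underline n,\underline n)$ of module $k$ (this is the composite of the class of $\tilde\alpha:\underline n\to \underline{k(n+1)-1}$ in $\Lambda$ with the morphism $\underline{k(n+1)-1}\to\underline n$ of module $k$ given by the identity map of $\mathbb Z$). Then $$\Lambda_n^k=\sum_{\alpha\in\Sigma_n^k}\epsilon(\mathrm{Perm}(\alpha))\,\tilde\alpha\in\mathbb Z[\tilde\Lambda].$$ *)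

theory Defs
  imports
    "HOL-Library.Poly_Mapping"
    "HOL-Library.FuncSet"
    "HOL-Combinatorics.Permutations"
begin

section \<open>The epicyclic category\<close>

text \<open>The object \<open>n\<close> is the set of integers with its usual order and the automorphism
  \<open>x \<mapsto> x + n + 1\<close>.\<close>

definition has_module :: "nat \<Rightarrow> nat \<Rightarrow> (int \<Rightarrow> int) \<Rightarrow> int \<Rightarrow> bool" where
  "has_module n m f k \<longleftrightarrow> (\<forall>x. f (x + (int n + 1)) = f x + k * (int m + 1))"

definition epi_map :: "nat \<Rightarrow> nat \<Rightarrow> (int \<Rightarrow> int) \<Rightarrow> bool" where
  "epi_map n m f \<longleftrightarrow> mono f \<and> (\<exists>k>0. has_module n m f k)"

definition epi_equiv :: "nat \<times> nat \<times> (int \<Rightarrow> int) \<Rightarrow> nat \<times> nat \<times> (int \<Rightarrow> int) \<Rightarrow> bool" where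
  "epi_equiv = (\<lambda>(n, m, f) (n', m', g). n = n' \<and> m = m' \<and> epi_map n m f \<and> epi_map n m g \<and>
     (\<exists>a::int. \<forall>x. g x = f x + a * (int m + 1)))"

lemma has_module_shift:
  assumes "has_module n m f k"
  shows "f (y + j * (int n + 1)) = f y + j * k * (int m + 1)"
proof -
  have *: "f (y + int j * (int n + 1)) = f y + int j * k * (int m + 1)" for y and j :: nat
  proof (induction j)
    case (Suc j)
    have "f (y + int (Suc j) * (int n + 1)) = f ((y + int j * (int n + 1)) + (int n + 1))"
      by (simp add: algebra_simps)
    also have "\<dots> = f (y + int j * (int n + 1)) + k * (int m + 1)"
      using assms unfolding has_module_def by blast
    finally show ?case using Suc by (simp add: algebra_simps)
  qed simp
  show ?thesis
  proof (cases "j \<ge> 0")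
    case True
    then show ?thesis using *[of y "nat j"] by simp
  next
    case False
    then show ?thesis using *[of "y + j * (int n + 1)" "nat (- j)"] by (simp add: algebra_simps)
  qed
qed

lemma has_module_comp:
  assumes "has_module n m f k" "has_module m p g l"
  shows "has_module n p (g \<circ> f) (k * l)"
  using assms(1) has_module_shift[OF assms(2)] unfolding has_module_def by simp

lemma epi_map_comp:
  assumes "epi_map n m f" "epi_map m p g"
  shows "epi_map n p (g \<circ> f)"
proof -
  obtain k l where "has_module n m f k" "k > 0" "has_module m p g l" "l > 0"
    using assms unfolding epi_map_def by blast
  then have "has_module n p (g \<circ> f) (k * l)" "k * l > 0"
    using has_module_comp by auto
  moreover have "mono (g \<circ> f)"
    using assms unfolding epi_map_def mono_def by auto
  ultimately show ?thesis unfolding epi_map_def by blast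
qed

lemma epi_map_id: "epi_map n n id"
  unfolding epi_map_def has_module_def by (auto intro!: exI[of _ 1] monoI)

lemma epi_equiv_refl: "epi_map n m f \<Longrightarrow> epi_equiv (n, m, f) (n, m, f)"
  unfolding epi_equiv_def by (auto intro!: exI[of _ 0])

lemma epi_equiv_part_equivp: "part_equivp epi_equiv"
proof (rule part_equivpI)
  show "\<exists>x. epi_equiv x x"
    using epi_equiv_refl[OF epi_map_id] by blast
  show "symp epi_equiv"
  proof (rule sympI)
    fix x y assume "epi_equiv x y"
    then obtain n m f g a where *: "x = (n, m, f)" "y = (n, m, g)" "epi_map n m f" "epi_map n m g"
      "\<forall>x. g x = f x + a * (int m + 1)"
      unfolding epi_equiv_def by auto
    then have "\<forall>x. f x = g x + (- a) * (int m + 1)" by (simp add: algebra_simps)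
    then show "epi_equiv y x" using * unfolding epi_equiv_def by blast
  qed
  show "transp epi_equiv"
  proof (rule transpI)
    fix x y z assume "epi_equiv x y" "epi_equiv y z"
    then obtain n m f g h a b where *: "x = (n, m, f)" "z = (n, m, h)" "epi_map n m f" "epi_map n m h"
      "\<forall>x. g x = f x + a * (int m + 1)" "\<forall>x. h x = g x + b * (int m + 1)"
      unfolding epi_equiv_def by auto
    then have "\<forall>x. h x = f x + (a + b) * (int m + 1)" by (simp add: algebra_simps)
    then show "epi_equiv x z" using * unfolding epi_equiv_def by blast
  qed
qed

text \<open>The type of all morphisms, carrying their source and target.\<close>

quotient_type epi_mor = "nat \<times> nat \<times> (int \<Rightarrow> int)" / partial: epi_equiv
  by (rule epi_equiv_part_equivp)

text \<open>The class of a map; only meaningful if \<open>epi_map n m f\<close>.\<close>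

definition epi_class :: "nat \<Rightarrow> nat \<Rightarrow> (int \<Rightarrow> int) \<Rightarrow> epi_mor" where
  "epi_class n m f = abs_epi_mor (n, m, f)"

lift_definition epi_source :: "epi_mor \<Rightarrow> nat" is "\<lambda>(n, m, f). n"
  by (auto simp: epi_equiv_def)

lift_definition epi_target :: "epi_mor \<Rightarrow> nat" is "\<lambda>(n, m, f). m"
  by (auto simp: epi_equiv_def)

lift_definition epi_module :: "epi_mor \<Rightarrow> int \<Rightarrow> bool" is "\<lambda>(n, m, f). has_module n m f"
  by (auto simp: epi_equiv_def has_module_def)

lift_definition epi_id :: "nat \<Rightarrow> epi_mor" is "\<lambda>n. (n, n, id)"
  by (simp add: epi_equiv_refl epi_map_id)

text \<open>\<open>epi_comp \<psi> \<phi>\<close> is \<open>\<psi> \<circ> \<phi>\<close>, or \<open>None\<close> if the two are not composable.\<close>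

lift_definition epi_comp :: "epi_mor \<Rightarrow> epi_mor \<Rightarrow> epi_mor option"
  is "\<lambda>(m', p, g) (n, m, f). if m = m' then Some (n, p, g \<circ> f) else None"
proof -
  fix x1 x2 y1 y2
  assume "epi_equiv x1 x2" "epi_equiv y1 y2"
  then obtain m' p g g' a n m f f' b where
    x: "x1 = (m', p, g)" "x2 = (m', p, g')" "epi_map m' p g" "epi_map m' p g'"
      "\<And>x. g' x = g x + a * (int p + 1)" and
    y: "y1 = (n, m, f)" "y2 = (n, m, f')" "epi_map n m f" "epi_map n m f'"
      "\<And>x. f' x = f x + b * (int m + 1)"
    unfolding epi_equiv_def by auto
  have "epi_equiv (n, p, g \<circ> f) (n, p, g' \<circ> f')" if "m = m'"
  proof -
    obtain l where "has_module m' p g l" using x(3) unfolding epi_map_def by blast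
    then have "has_module m p g l" using \<open>m = m'\<close> by simp
    then have "\<forall>x. (g' \<circ> f') x = (g \<circ> f) x + (b * l + a) * (int p + 1)"
      unfolding x y comp_apply by (simp add: has_module_shift distrib_right)
    then show ?thesis
      using epi_map_comp[of n m f p g] epi_map_comp[of n m f' p g'] x(3,4) y(3,4) that
      unfolding epi_equiv_def by blast
  qed
  then show "rel_option epi_equiv
      ((\<lambda>(m', p, g) (n, m, f). if m = m' then Some (n, p, g \<circ> f) else None) x1 y1)
      ((\<lambda>(m', p, g) (n, m, f). if m = m' then Some (n, p, g \<circ> f) else None) x2 y2)"
    by (simp add: x y)
qed

definition epi_hom :: "nat \<Rightarrow> nat \<Rightarrow> epi_mor set" where
  "epi_hom n m = {\<phi>. epi_source \<phi> = n \<and> epi_target \<phi> = m}"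

definition cyc_hom :: "nat \<Rightarrow> nat \<Rightarrow> epi_mor set" where
  "cyc_hom n m = {\<phi> \<in> epi_hom n m. epi_module \<phi> 1}"

definition cyc_aut :: "nat \<Rightarrow> epi_mor set" where
  "cyc_aut n = {\<tau> \<in> cyc_hom n n. \<exists>\<sigma> \<in> cyc_hom n n.
     epi_comp \<sigma> \<tau> = Some (epi_id n) \<and> epi_comp \<tau> \<sigma> = Some (epi_id n)}"

lemma epi_mor_cases:
  obtains n m f where "\<phi> = epi_class n m f" "epi_map n m f"
proof -
  obtain n m f where nmf: "rep_epi_mor \<phi> = (n, m, f)" by (cases "rep_epi_mor \<phi>")
  have "epi_equiv (rep_epi_mor \<phi>) (rep_epi_mor \<phi>)"
    using Quotient3_epi_mor Quotient3_rep_reflp by fastforce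
  then have "epi_map n m f" unfolding nmf epi_equiv_def by simp
  moreover have "\<phi> = epi_class n m f"
    unfolding epi_class_def nmf[symmetric] using Quotient3_epi_mor Quotient3_abs_rep by fastforce
  ultimately show thesis using that by blast
qed

lemma epi_class_eq_iff:
  assumes "epi_map n m f" "epi_map n' m' g"
  shows "epi_class n m f = epi_class n' m' g \<longleftrightarrow>
    n = n' \<and> m = m' \<and> (\<exists>a::int. \<forall>x. g x = f x + a * (int m + 1))"
proof -
  have "epi_class n m f = epi_class n' m' g \<longleftrightarrow> epi_equiv (n, m, f) (n', m', g)"
    unfolding epi_class_def
    using assms Quotient3_rel[OF Quotient3_epi_mor] epi_equiv_refl by blast
  then show ?thesis using assms unfolding epi_equiv_def by auto
qed

lemma epi_class_simps:
  assumes "epi_map n m f"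
  shows "epi_source (epi_class n m f) = n" "epi_target (epi_class n m f) = m"
    "epi_module (epi_class n m f) = has_module n m f"
  using epi_equiv_refl[OF assms] unfolding epi_class_def
  by (simp_all add: epi_source.abs_eq epi_target.abs_eq epi_module.abs_eq)

lemma epi_id_eq: "epi_id n = epi_class n n id"
  unfolding epi_class_def by (simp add: epi_id.abs_eq)

lemma epi_comp_class:
  assumes "epi_map n m f" "epi_map m' p g"
  shows "epi_comp (epi_class m' p g) (epi_class n m f) =
    (if m = m' then Some (epi_class n p (g \<circ> f)) else None)"
  using epi_equiv_refl[OF assms(1)] epi_equiv_refl[OF assms(2)] unfolding epi_class_def
  by (simp add: epi_comp.abs_eq)

lemma epi_comp_assoc:
  "Option.bind (epi_comp \<chi> \<psi>) (\<lambda>\<theta>. epi_comp \<theta> \<phi>) = Option.bind (epi_comp \<psi> \<phi>) (epi_comp \<chi>)"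
proof -
  obtain n1 m1 f1 where 1: "\<chi> = epi_class n1 m1 f1" "epi_map n1 m1 f1" by (rule epi_mor_cases)
  obtain n2 m2 f2 where 2: "\<psi> = epi_class n2 m2 f2" "epi_map n2 m2 f2" by (rule epi_mor_cases)
  obtain n3 m3 f3 where 3: "\<phi> = epi_class n3 m3 f3" "epi_map n3 m3 f3" by (rule epi_mor_cases)
  show ?thesis
    using 1(2) 2(2) 3(2) epi_map_comp[of n2 m2 f2 m1 f1] epi_map_comp[of n3 m3 f3 m2 f2]
    by (auto simp: 1(1) 2(1) 3(1) epi_comp_class comp_assoc)
qed


section \<open>The ring of formal integral combinations of morphisms\<close>

text \<open>The instance \<open>times\<close> of \<^typ>\<open>'a \<Rightarrow>\<^sub>0 'b\<close> needs a monoid of keys, so the product is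
  written \<open>\<odot>\<close>.\<close>

type_synonym epi_ring = "epi_mor \<Rightarrow>\<^sub>0 int"

definition epi_mult :: "epi_ring \<Rightarrow> epi_ring \<Rightarrow> epi_ring"  (infixl "\<odot>" 70) where
  "F \<odot> G = frag_extend (\<lambda>\<psi>. frag_extend (\<lambda>\<phi>.
     case epi_comp \<psi> \<phi> of None \<Rightarrow> 0 | Some \<theta> \<Rightarrow> frag_of \<theta>) G) F"

lemma epi_mult_of:
  "frag_of \<psi> \<odot> frag_of \<phi> = (case epi_comp \<psi> \<phi> of None \<Rightarrow> 0 | Some \<theta> \<Rightarrow> frag_of \<theta>)"
  by (simp add: epi_mult_def)

lemma epi_mult_distrib_right: "(F + G) \<odot> H = F \<odot> H + G \<odot> H"
  by (simp add: epi_mult_def frag_extend_add)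

lemma epi_mult_distrib_left: "F \<odot> (G + H) = F \<odot> G + F \<odot> H"
proof -
  have "frag_extend (\<lambda>x. f x + g x) F = frag_extend f F + frag_extend g F"
    for f g :: "epi_mor \<Rightarrow> epi_ring"
    by (simp add: frag_extend_def frag_cmul_distrib2 sum.distrib)
  then show ?thesis by (simp add: epi_mult_def frag_extend_add)
qed

lemma epi_mult_zero [simp]: "0 \<odot> F = 0" "F \<odot> 0 = 0"
  by (simp_all add: epi_mult_def frag_extend_def)

lemma epi_mult_diff: "(F - G) \<odot> H = F \<odot> H - G \<odot> H" "F \<odot> (G - H) = F \<odot> G - F \<odot> H"
  using epi_mult_distrib_right[of "F - G" G H] epi_mult_distrib_left[of F "G - H" H]
  by (simp_all add: algebra_simps)

lemma epi_mult_assoc: "(F \<odot> G) \<odot> H = F \<odot> (G \<odot> H)"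
proof -
  have of: "(frag_of \<chi> \<odot> frag_of \<psi>) \<odot> frag_of \<phi> = frag_of \<chi> \<odot> (frag_of \<psi> \<odot> frag_of \<phi>)"
    for \<chi> \<psi> \<phi>
    using epi_comp_assoc[of \<chi> \<psi> \<phi>]
    by (auto simp: epi_mult_of split: option.splits bind_splits)
  have 1: "(frag_of \<chi> \<odot> frag_of \<psi>) \<odot> H = frag_of \<chi> \<odot> (frag_of \<psi> \<odot> H)" for \<chi> \<psi>
    by (induction H rule: frag_induction[OF subset_UNIV])
      (simp_all add: of epi_mult_diff)
  have 2: "(frag_of \<chi> \<odot> G) \<odot> H = frag_of \<chi> \<odot> (G \<odot> H)" for \<chi>
    by (induction G rule: frag_induction[OF subset_UNIV])
      (simp_all add: 1 epi_mult_diff)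
  show ?thesis
    by (induction F rule: frag_induction[OF subset_UNIV])
      (simp_all add: 2 epi_mult_diff)
qed


section \<open>The operator \<open>B\<close>\<close>

text \<open>The residues modulo \<open>n + 1\<close> are represented by \<open>{0..n}\<close>; the induced map is
  extended by the identity outside this set, as required by \<^const>\<open>sign\<close>.\<close>

lift_definition aut_perm :: "epi_mor \<Rightarrow> int \<Rightarrow> int"
  is "\<lambda>(n, m, f) j. if j \<in> {0..int n} then f j mod (int m + 1) else j"
  by (auto simp: epi_equiv_def fun_eq_iff)

definition aut_alt_sum :: "nat \<Rightarrow> epi_ring" where
  "aut_alt_sum n = (\<Sum>\<tau> \<in> cyc_aut n. frag_cmul (sign (aut_perm \<tau>)) (frag_of \<tau>))"

text \<open>This is \<open>i + a * (n + 1) \<mapsto> 1 + i + a * (n + 2)\<close> for \<open>0 \<le> i \<le> n\<close>.\<close>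

definition B0_map :: "nat \<Rightarrow> int \<Rightarrow> int" where
  "B0_map n x = 1 + x mod (int n + 1) + (x div (int n + 1)) * (int n + 2)"

definition B0 :: "nat \<Rightarrow> epi_mor" where
  "B0 n = epi_class n (n + 1) (B0_map n)"

definition B :: "nat \<Rightarrow> epi_ring" where
  "B n = frag_of (B0 n) \<odot> aut_alt_sum n"


section \<open>The elements \<open>\<Lambda>\<^sub>n\<^sup>k\<close>\<close>

text \<open>The interval morphisms \<open>{0..p} \<rightarrow> {0..q}\<close>.\<close>

definition interval_hom :: "int \<Rightarrow> int \<Rightarrow> (int \<Rightarrow> int) set" where
  "interval_hom p q = {\<alpha> \<in> {0..p} \<rightarrow>\<^sub>E {0..q}. mono_on {0..p} \<alpha> \<and> \<alpha> 0 = 0 \<and> \<alpha> p = q}"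

definition Sigma_set :: "nat \<Rightarrow> nat \<Rightarrow> (int \<Rightarrow> int) set" where
  "Sigma_set n k = {\<alpha> \<in> interval_hom (int n + 1) (int k * (int n + 1)).
     bij_betw (\<lambda>j. \<alpha> j mod (int n + 1)) {0..int n} {0..int n}}"

definition Sigma_perm :: "nat \<Rightarrow> (int \<Rightarrow> int) \<Rightarrow> int \<Rightarrow> int" where
  "Sigma_perm n \<alpha> j = (if j \<in> {1..int n} then \<alpha> j mod (int n + 1) else j)"

definition tilde_map :: "nat \<Rightarrow> nat \<Rightarrow> (int \<Rightarrow> int) \<Rightarrow> int \<Rightarrow> int" where
  "tilde_map n k \<alpha> x = \<alpha> (x mod (int n + 1)) + (x div (int n + 1)) * (int k * (int n + 1))"

definition Lam :: "nat \<Rightarrow> nat \<Rightarrow> epi_ring" where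
  "Lam n k = (\<Sum>\<alpha> \<in> Sigma_set n k.
     frag_cmul (sign (Sigma_perm n \<alpha>)) (frag_of (epi_class n n (tilde_map n k \<alpha>))))"


section \<open>Well-definedness\<close>

lemma epi_map_shift: "epi_map n n (\<lambda>x. x + c)"
  unfolding epi_map_def has_module_def by (auto intro!: exI[of _ 1] monoI)

lemma mono_block:
  fixes h :: "int \<Rightarrow> int"
  assumes "\<And>x y. 0 \<le> x \<Longrightarrow> x \<le> y \<Longrightarrow> y \<le> int n \<Longrightarrow> h x \<le> h y"
    and "\<And>x. 0 \<le> x \<Longrightarrow> x \<le> int n \<Longrightarrow> c \<le> h x \<and> h x \<le> c + d" and "d \<ge> 0"
  shows "mono (\<lambda>x. h (x mod (int n + 1)) + (x div (int n + 1)) * d)"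
proof (rule monoI)
  fix x y :: int assume xy: "x \<le> y"
  define N where "N = int n + 1"
  have N: "N > 0" by (simp add: N_def)
  have r: "0 \<le> z mod N" "z mod N \<le> int n" for z
    using N pos_mod_bound[of N z] by (auto simp: N_def)
  have le: "x div N \<le> y div N" using xy N by (simp add: zdiv_mono1)
  show "h (x mod N) + (x div N) * d \<le> h (y mod N) + (y div N) * d"
  proof (cases "x div N = y div N")
    case True
    have "x mod N \<le> y mod N"
      using xy True by (metis add_le_cancel_left mult_div_mod_eq)
    then show ?thesis using assms(1)[of "x mod N" "y mod N"] r True by simp
  next
    case False
    then have "x div N + 1 \<le> y div N" using le by simp
    then have "(x div N + 1) * d \<le> (y div N) * d" using assms(3) by (rule mult_right_mono)
    then show ?thesis
      using assms(2)[of "x mod N"] assms(2)[of "y mod N"] r by (simp add: algebra_simps)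
  qed
qed

lemma B0_map_epi: "has_module n (n + 1) (B0_map n) 1" "epi_map n (n + 1) (B0_map n)"
proof -
  show *: "has_module n (n + 1) (B0_map n) 1"
  proof -
    have "(x + (int n + 1)) div (int n + 1) = x div (int n + 1) + 1" for x
      by (rule div_add_self2) simp
    then show ?thesis unfolding has_module_def B0_map_def by (simp add: distrib_right)
  qed
  have "mono (B0_map n)"
    using mono_block[of n "\<lambda>x. 1 + x" 0 "int n + 2"] unfolding B0_map_def by simp
  then show "epi_map n (n + 1) (B0_map n)" using * unfolding epi_map_def by force
qed

lemma B0_map_eq:
  "0 \<le> i \<Longrightarrow> i \<le> int n \<Longrightarrow> B0_map n (i + a * (int n + 1)) = 1 + i + a * (int n + 2)"
  unfolding B0_map_def by simp

lemma tilde_map_mono: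
  assumes "\<alpha> \<in> interval_hom (int n + 1) (int k * (int n + 1))"
  shows "mono (tilde_map n k \<alpha>)"
proof -
  have "mono_on {0..int n + 1} \<alpha>" "\<alpha> \<in> {0..int n + 1} \<rightarrow> {0..int k * (int n + 1)}"
    using assms unfolding interval_hom_def by (auto simp: PiE_def)
  then have "\<And>x y. 0 \<le> x \<Longrightarrow> x \<le> y \<Longrightarrow> y \<le> int n \<Longrightarrow> \<alpha> x \<le> \<alpha> y"
    "\<And>x. 0 \<le> x \<Longrightarrow> x \<le> int n \<Longrightarrow> 0 \<le> \<alpha> x \<and> \<alpha> x \<le> 0 + int k * (int n + 1)"
    by (auto simp: mono_on_def Pi_def)
  then show ?thesis
    using mono_block[of n \<alpha> 0 "int k * (int n + 1)"] unfolding tilde_map_def by fastforce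
qed

lemma tilde_map_shift:
  "tilde_map n k \<alpha> (x + (int n + 1)) = tilde_map n k \<alpha> x + int k * (int n + 1)"
proof -
  have "(x + (int n + 1)) div (int n + 1) = x div (int n + 1) + 1"
    by (rule div_add_self2) simp
  then show ?thesis unfolding tilde_map_def by (simp add: distrib_right)
qed

lemma tilde_map_epi:
  assumes "\<alpha> \<in> Sigma_set n k" "k > 0"
  shows "has_module n n (tilde_map n k \<alpha>) (int k)" "epi_map n n (tilde_map n k \<alpha>)"
proof -
  show *: "has_module n n (tilde_map n k \<alpha>) (int k)"
    unfolding has_module_def by (simp add: tilde_map_shift)
  show "epi_map n n (tilde_map n k \<alpha>)"
    using * tilde_map_mono assms unfolding epi_map_def Sigma_set_def by force
qed

lemma tilde_map_extends:
  assumes "\<alpha> \<in> Sigma_set n k" "j \<in> {0..int n + 1}"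
  shows "tilde_map n k \<alpha> j = \<alpha> j"
  using assms unfolding tilde_map_def Sigma_set_def interval_hom_def
  by (cases "j = int n + 1") auto

lemma tilde_map_factor:
  assumes "\<alpha> \<in> Sigma_set n k" "k > 0"
  defines "N \<equiv> k * (n + 1) - 1"
  shows "epi_class n N (tilde_map n k \<alpha>) \<in> cyc_hom n N"
    "epi_module (epi_class N n id) (int k)"
    "epi_comp (epi_class N n id) (epi_class n N (tilde_map n k \<alpha>)) =
       Some (epi_class n n (tilde_map n k \<alpha>))"
proof -
  have N: "int N + 1 = int k * (int n + 1)"
    unfolding N_def using assms(2) by (simp add: of_nat_diff algebra_simps)
  have 1: "has_module n N (tilde_map n k \<alpha>) 1"
    unfolding has_module_def by (simp add: tilde_map_shift N)
  have 2: "epi_map n N (tilde_map n k \<alpha>)"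
    using 1 tilde_map_mono assms unfolding epi_map_def Sigma_set_def by force
  have 3: "has_module N n id (int k)"
    unfolding has_module_def by (simp add: N)
  have 4: "epi_map N n id"
    using 3 assms(2) unfolding epi_map_def by (auto intro!: exI[of _ "int k"] monoI)
  show "epi_class n N (tilde_map n k \<alpha>) \<in> cyc_hom n N"
    using 1 2 by (simp add: cyc_hom_def epi_hom_def epi_class_simps)
  show "epi_module (epi_class N n id) (int k)"
    using 3 4 by (simp add: epi_class_simps)
  show "epi_comp (epi_class N n id) (epi_class n N (tilde_map n k \<alpha>)) =
       Some (epi_class n n (tilde_map n k \<alpha>))"
    using 2 4 by (simp add: epi_comp_class)
qed

lemma finite_Sigma_set: "finite (Sigma_set n k)"
proof -
  have "Sigma_set n k \<subseteq> {0..int n + 1} \<rightarrow>\<^sub>E {0..int k * (int n + 1)}"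
    unfolding Sigma_set_def interval_hom_def by blast
  then show ?thesis by (rule finite_subset) (simp add: finite_PiE)
qed

lemma Sigma_perm_permutes:
  assumes "\<alpha> \<in> Sigma_set n k"
  shows "Sigma_perm n \<alpha> permutes {1..int n}"
proof (rule bij_imp_permutes)
  have b: "bij_betw (\<lambda>j. \<alpha> j mod (int n + 1)) {0..int n} {0..int n}" and "\<alpha> 0 = 0"
    using assms unfolding Sigma_set_def interval_hom_def by auto
  then have "bij_betw (\<lambda>j. \<alpha> j mod (int n + 1)) ({0..int n} - {0}) ({0..int n} - {0})"
    using bij_betw_DiffI[OF b, of "{0}" "{0}"] by (simp add: bij_betw_def)
  moreover have "{0..int n} - {0} = {1..int n}" by auto
  ultimately have "bij_betw (\<lambda>j. \<alpha> j mod (int n + 1)) {1..int n} {1..int n}" by simp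
  then show "bij_betw (Sigma_perm n \<alpha>) {1..int n} {1..int n}"
    by (rule bij_betw_cong[THEN iffD1, rotated]) (simp add: Sigma_perm_def)
qed (auto simp: Sigma_perm_def)

lemma aut_perm_class:
  "epi_map n m f \<Longrightarrow>
   aut_perm (epi_class n m f) j = (if j \<in> {0..int n} then f j mod (int m + 1) else j)"
  using epi_equiv_refl unfolding epi_class_def by (simp add: aut_perm.abs_eq)

lemma cyc_aut_eq: "cyc_aut n = (\<lambda>c. epi_class n n (\<lambda>x. x + c)) ` {0..int n}"
proof (intro equalityI subsetI)
  fix \<tau> assume \<tau>: "\<tau> \<in> cyc_aut n"
  then obtain \<sigma> where *: "\<tau> \<in> cyc_hom n n" "\<sigma> \<in> cyc_hom n n"
    "epi_comp \<sigma> \<tau> = Some (epi_id n)" "epi_comp \<tau> \<sigma> = Some (epi_id n)"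
    unfolding cyc_aut_def by auto
  obtain n1 m1 f where "\<tau> = epi_class n1 m1 f" "epi_map n1 m1 f" by (rule epi_mor_cases)
  then have f: "\<tau> = epi_class n n f" "epi_map n n f" "has_module n n f 1"
    using *(1) by (auto simp: cyc_hom_def epi_hom_def epi_class_simps)
  obtain n2 m2 g where "\<sigma> = epi_class n2 m2 g" "epi_map n2 m2 g" by (rule epi_mor_cases)
  then have g: "\<sigma> = epi_class n n g" "epi_map n n g"
    using *(2) by (auto simp: cyc_hom_def epi_hom_def epi_class_simps)
  have "\<exists>a. \<forall>x. x = g (f x) + a * (int n + 1)" "\<exists>b. \<forall>x. x = f (g x) + b * (int n + 1)"
    using *(3,4) f(1,2) g epi_map_id[of n] epi_map_comp[OF f(2) g(2)] epi_map_comp[OF g(2) f(2)]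
    by (simp_all add: epi_comp_class epi_id_eq epi_class_eq_iff)
  then obtain a b where ab: "\<And>x. x = g (f x) + a * (int n + 1)" "\<And>x. x = f (g x) + b * (int n + 1)"
    by blast
  have inj: "f x = f y \<Longrightarrow> x = y" for x y using ab(1) by metis
  have surj: "\<exists>x. f x = y" for y
  proof -
    have "f (g y + b * (int n + 1)) = y"
      using has_module_shift[OF f(3), of "g y" b] ab(2)[of y] by simp
    then show ?thesis by blast
  qed
  have mono: "mono f" using f(2) by (simp add: epi_map_def)
  have suc: "f (x + 1) = f x + 1" for x
  proof -
    have "f x \<le> f (x + 1)" using mono by (simp add: monoD)
    moreover have "f x \<noteq> f (x + 1)" using inj[of x "x + 1"] by auto
    moreover obtain z where z: "f z = f x + 1" using surj by blast
    moreover have "z > x" using z monoD[OF mono, of z x] by (cases "z \<le> x") auto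
    ultimately show ?thesis using monoD[OF mono, of "x + 1" z] by simp
  qed
  have fx: "f x = x + f 0" for x
  proof (induction x rule: int_induct[where k = 0])
    case (step1 i) then show ?case using suc[of i] by simp
  next
    case (step2 i) then show ?case using suc[of "i - 1"] by simp
  qed simp
  define c where "c = f 0 mod (int n + 1)"
  have "\<forall>x. x + c = f x + (- (f 0 div (int n + 1))) * (int n + 1)"
  proof
    fix x
    have "f 0 = (f 0 div (int n + 1)) * (int n + 1) + c"
      by (simp only: c_def div_mult_mod_eq)
    then show "x + c = f x + (- (f 0 div (int n + 1))) * (int n + 1)"
      using fx[of x] unfolding mult_minus_left by linarith
  qed
  then have "\<tau> = epi_class n n (\<lambda>x. x + c)"
    using f(1,2) epi_map_shift[of n c] epi_class_eq_iff by blast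
  moreover have "c \<in> {0..int n}"
    unfolding c_def using pos_mod_bound[of "int n + 1" "f 0"] by simp
  ultimately show "\<tau> \<in> (\<lambda>c. epi_class n n (\<lambda>x. x + c)) ` {0..int n}" by blast
next
  fix \<tau> assume "\<tau> \<in> (\<lambda>c. epi_class n n (\<lambda>x. x + c)) ` {0..int n}"
  then obtain c where c: "\<tau> = epi_class n n (\<lambda>x. x + c)" by blast
  have h: "epi_class n n (\<lambda>x. x + d) \<in> cyc_hom n n" for d
    by (simp add: cyc_hom_def epi_hom_def epi_class_simps epi_map_shift has_module_def)
  have "epi_comp (epi_class n n (\<lambda>x. x + d)) (epi_class n n (\<lambda>x. x - d)) = Some (epi_id n)" for d
    using epi_map_shift[of n d] epi_map_shift[of n "- d"]
    by (simp add: epi_comp_class epi_id_eq comp_def id_def)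
  from this[of c] this[of "- c"] show "\<tau> \<in> cyc_aut n"
    using h[of c] h[of "- c"] unfolding cyc_aut_def c by auto
qed

lemma finite_cyc_aut: "finite (cyc_aut n)"
  unfolding cyc_aut_eq by simp

lemma card_cyc_aut: "card (cyc_aut n) = n + 1"
proof -
  have "c = d"
    if cd: "c \<in> {0..int n}" "d \<in> {0..int n}"
      and eq: "epi_class n n (\<lambda>x. x + c) = epi_class n n (\<lambda>x. x + d)" for c d
  proof -
    obtain a :: int where a: "\<forall>x. x + d = x + c + a * (int n + 1)"
      using eq unfolding epi_class_eq_iff[OF epi_map_shift[of n c] epi_map_shift[of n d]] by blast
    have "d = c + a * (int n + 1)" using a[rule_format, of 0] by simp
    then have "d mod (int n + 1) = c mod (int n + 1)" by simp
    then show ?thesis using cd by simp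
  qed
  then have "inj_on (\<lambda>c. epi_class n n (\<lambda>x. x + c)) {0..int n}" by (rule inj_onI)
  then show ?thesis unfolding cyc_aut_eq by (simp add: card_image)
qed

lemma aut_perm_permutes:
  assumes "\<tau> \<in> cyc_aut n"
  shows "aut_perm \<tau> permutes {0..int n}"
proof -
  obtain c where \<tau>: "\<tau> = epi_class n n (\<lambda>x. x + c)"
    using assms unfolding cyc_aut_eq by blast
  have ap: "aut_perm \<tau> j = (if j \<in> {0..int n} then (j + c) mod (int n + 1) else j)" for j
    unfolding \<tau> by (rule aut_perm_class[OF epi_map_shift])
  have inj: "inj_on (aut_perm \<tau>) {0..int n}"
  proof (rule inj_onI)
    fix x y assume xy: "x \<in> {0..int n}" "y \<in> {0..int n}" "aut_perm \<tau> x = aut_perm \<tau> y"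
    then have "((x + c) mod (int n + 1) - c) mod (int n + 1) =
        ((y + c) mod (int n + 1) - c) mod (int n + 1)"
      by (simp add: ap)
    then have "x mod (int n + 1) = y mod (int n + 1)" by (simp add: mod_diff_left_eq)
    then show "x = y" using xy by simp
  qed
  have "aut_perm \<tau> ` {0..int n} \<subseteq> {0..int n}"
  proof
    fix y assume "y \<in> aut_perm \<tau> ` {0..int n}"
    then obtain x where "y = (x + c) mod (int n + 1)" by (auto simp: ap)
    then show "y \<in> {0..int n}" using pos_mod_bound[of "int n + 1" "x + c"] by simp
  qed
  then have "bij_betw (aut_perm \<tau>) {0..int n} {0..int n}"
    using inj endo_inj_surj[of "{0..int n}"] by (simp add: bij_betw_def)
  then show ?thesis by (rule bij_imp_permutes) (auto simp: ap)
qed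

end

theory Submission
  imports Defs
begin

text \<open>Let \<open>f\<close> run over the non-decreasing maps of module \<open>k\<close> that permute the residues modulo
  \<open>n + 1\<close>. Composing \<open>\<Lambda>\<^sub>n\<^sup>k\<close> with the alternating sum \<open>A\<close> removes the normalisation \<open>f 0 = 0\<close>, so
  the right-hand side is the signed sum of the classes of \<open>B\<^sub>0 \<circ> f\<close> over all \<open>f\<close> with
  \<open>0 \<le> f 0 < k * (n + 1)\<close>: the factor \<open>k\<close> counts the translates by multiples of \<open>n + 1\<close> in this range.
  On the left, \<open>h \<circ> B\<^sub>0 \<circ> \<tau>\<close> avoids the multiples of \<open>n + 2\<close>, hence equals \<open>B\<^sub>0 \<circ> f\<close> for a unique
  \<open>f\<close>. Conversely, \<open>f\<close> determines \<open>\<tau>\<close>, since \<open>\<tau>\<close> rotates to \<open>0\<close> the place where \<open>f\<close> changes from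
  negative to non-negative values, and then \<open>h\<close>, by sending \<open>0\<close> to \<open>0\<close>. The residue permutations of
  \<open>f\<close> and of \<open>h\<close> composed with \<open>\<tau>\<close> have equal signs because \<open>h\<close> fixes the residue \<open>0\<close>.\<close>

section \<open>Products of finite sums\<close>

lemma epi_mult_sum_left: "finite I \<Longrightarrow> (\<Sum>i\<in>I. F i) \<odot> H = (\<Sum>i\<in>I. F i \<odot> H)"
  by (induction I rule: finite_induct) (simp_all add: epi_mult_distrib_right)

lemma epi_mult_sum_right: "finite I \<Longrightarrow> H \<odot> (\<Sum>i\<in>I. F i) = (\<Sum>i\<in>I. H \<odot> F i)"
  by (induction I rule: finite_induct) (simp_all add: epi_mult_distrib_left)

lemma epi_mult_cmul_left: "frag_cmul c F \<odot> H = frag_cmul c (F \<odot> H)"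
  by (simp add: epi_mult_def frag_extend_cmul)

text \<open>\<open>epi_mult\<close> extends linearly in its left factor first, so a scalar on the
  right is moved out for a basis element and then for general \<open>H\<close> by induction.\<close>

lemma epi_mult_cmul_right: "H \<odot> frag_cmul c F = frag_cmul c (H \<odot> F)"
proof -
  have "frag_of \<psi> \<odot> frag_cmul c F = frag_cmul c (frag_of \<psi> \<odot> F)" for \<psi>
    by (simp add: epi_mult_def frag_extend_cmul)
  moreover have "frag_cmul c (x - y) = frag_cmul c x - frag_cmul c y" for x y :: epi_ring
    by (simp add: poly_mapping_eqI lookup_minus right_diff_distrib)
  ultimately show ?thesis
    by (induction H rule: frag_induction[OF subset_UNIV]) (simp_all add: epi_mult_diff)
qed

lemma epi_mult_of_class:
  assumes "epi_map n m f" "epi_map m p g"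
  shows "frag_of (epi_class m p g) \<odot> frag_of (epi_class n m f) = frag_of (epi_class n p (g \<circ> f))"
  using assms by (simp add: epi_mult_of epi_comp_class)

section \<open>Maps inducing permutations of the residues\<close>

text \<open>Works on maps rather than classes and covers both \<open>aut_perm\<close> and
  \<open>Sigma_perm\<close>, so that one multiplicative sign serves \<open>A\<close> and the
  elements \<open>Lam\<close>.\<close>

definition residue_map :: "nat \<Rightarrow> (int \<Rightarrow> int) \<Rightarrow> int \<Rightarrow> int" where
  "residue_map n f j = (if j \<in> {0..int n} then f j mod (int n + 1) else j)"

definition residue_sign :: "nat \<Rightarrow> (int \<Rightarrow> int) \<Rightarrow> int" where
  "residue_sign n f = sign (residue_map n f)"

text \<open>A map with a module acts on the finite set of residues, where injectivity already gives
  a permutation. Quantifying over all integers makes closure under composition immediate.\<close>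

definition perm_maps :: "nat \<Rightarrow> nat \<Rightarrow> (int \<Rightarrow> int) set" where
  "perm_maps n k = {f. mono f \<and> has_module n n f (int k) \<and>
     (\<forall>x y. f x mod (int n + 1) = f y mod (int n + 1) \<longrightarrow> x mod (int n + 1) = y mod (int n + 1))}"

definition pointed_perm_maps :: "nat \<Rightarrow> nat \<Rightarrow> (int \<Rightarrow> int) set" where
  "pointed_perm_maps n k = {f \<in> perm_maps n k. f 0 = 0}"

lemma perm_mapsD:
  assumes "f \<in> perm_maps n k"
  shows "mono f" "has_module n n f (int k)"
    "f x mod (int n + 1) = f y mod (int n + 1) \<Longrightarrow> x mod (int n + 1) = y mod (int n + 1)"
  using assms unfolding perm_maps_def by blast+

lemma perm_maps_epi: "f \<in> perm_maps n k \<Longrightarrow> k > 0 \<Longrightarrow> epi_map n n f"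
  unfolding perm_maps_def epi_map_def by force

lemma perm_maps_shift:
  assumes "f \<in> perm_maps n k"
  shows "f (x + j * (int n + 1)) = f x + j * (int k * (int n + 1))"
  using has_module_shift[OF perm_mapsD(2)[OF assms]] by (simp add: mult.assoc)

lemma perm_maps_mod:
  assumes "f \<in> perm_maps n k"
  shows "f (x mod (int n + 1)) mod (int n + 1) = f x mod (int n + 1)"
proof -
  have "f x = f (x mod (int n + 1) + (x div (int n + 1)) * (int n + 1))"
    by (simp only: mod_div_mult_eq)
  also have "\<dots> = f (x mod (int n + 1)) + (x div (int n + 1) * int k) * (int n + 1)"
    unfolding perm_maps_shift[OF assms] by simp
  finally show ?thesis by simp
qed

text \<open>For \<open>n > 0\<close> neighbouring integers have different residues, so a monotone
  map that is injective on residues cannot be constant on them.\<close>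

lemma perm_maps_strict_mono:
  assumes "f \<in> perm_maps n k" "n > 0"
  shows "strict_mono f"
proof -
  have strict: "f x < f (x + 1)" for x
  proof -
    have "(x + 1) mod (int n + 1) \<noteq> x mod (int n + 1)"
    proof
      assume "(x + 1) mod (int n + 1) = x mod (int n + 1)"
      then have "int n + 1 dvd 1" by (simp add: mod_eq_dvd_iff)
      then show False using assms(2) by simp
    qed
    then have "f (x + 1) \<noteq> f x" using perm_mapsD(3)[OF assms(1), of "x + 1" x] by auto
    moreover have "f x \<le> f (x + 1)" using perm_mapsD(1)[OF assms(1)] by (simp add: monoD)
    ultimately show ?thesis by simp
  qed
  have "f x < f y" if "x < y" for x y
    using that
  proof (induction y rule: int_gr_induct)
    case (step i) then show ?case using strict[of i] by simp
  qed (rule strict)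
  then show ?thesis by (simp add: strict_monoI)
qed

lemma perm_maps_residue_bij:
  assumes "f \<in> perm_maps n k"
  shows "bij_betw (\<lambda>j. f j mod (int n + 1)) {0..int n} {0..int n}"
proof -
  have "inj_on (\<lambda>j. f j mod (int n + 1)) {0..int n}"
  proof (rule inj_onI)
    fix x y assume "x \<in> {0..int n}" "y \<in> {0..int n}" "f x mod (int n + 1) = f y mod (int n + 1)"
    then show "x = y" using perm_mapsD(3)[OF assms, of x y] by simp
  qed
  moreover have "f j mod (int n + 1) \<in> {0..int n}" for j
    using pos_mod_bound[of "int n + 1" "f j"] by simp
  then have "(\<lambda>j. f j mod (int n + 1)) ` {0..int n} \<subseteq> {0..int n}" by blast
  ultimately show ?thesis
    by (simp add: bij_betw_def endo_inj_surj)
qed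

lemma residue_map_permutes:
  assumes "f \<in> perm_maps n k"
  shows "residue_map n f permutes {0..int n}"
proof (rule bij_imp_permutes)
  show "bij_betw (residue_map n f) {0..int n} {0..int n}"
    using perm_maps_residue_bij[OF assms]
    by (rule bij_betw_cong[THEN iffD1, rotated]) (simp add: residue_map_def)
qed (auto simp: residue_map_def)

lemma perm_maps_comp:
  assumes "f \<in> perm_maps n k" "g \<in> perm_maps n l"
  shows "g \<circ> f \<in> perm_maps n (k * l)"
proof -
  have "mono (g \<circ> f)"
    using perm_mapsD(1)[OF assms(1)] perm_mapsD(1)[OF assms(2)] by (simp add: mono_def)
  moreover have "has_module n n (g \<circ> f) (int (k * l))"
    using has_module_comp[OF perm_mapsD(2)[OF assms(1)] perm_mapsD(2)[OF assms(2)]] by simp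
  moreover have "x mod (int n + 1) = y mod (int n + 1)"
    if "(g \<circ> f) x mod (int n + 1) = (g \<circ> f) y mod (int n + 1)" for x y
    by (rule perm_mapsD(3)[OF assms(1) perm_mapsD(3)[OF assms(2) that[unfolded comp_apply]]])
  ultimately show ?thesis unfolding perm_maps_def by blast
qed

text \<open>Periodicity allows \<open>g\<close> to be evaluated at the residue of
  \<open>f x\<close>, so passing to residue maps respects composition.\<close>

lemma residue_sign_comp:
  assumes "f \<in> perm_maps n k" "g \<in> perm_maps n l"
  shows "residue_sign n (g \<circ> f) = residue_sign n g * residue_sign n f"
proof -
  have "f x mod (int n + 1) \<in> {0..int n}" for x
    using pos_mod_bound[of "int n + 1" "f x"] by simp
  then have "residue_map n (g \<circ> f) = residue_map n g \<circ> residue_map n f"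
    by (auto simp: fun_eq_iff residue_map_def perm_maps_mod[OF assms(2)])
  moreover have "permutation (residue_map n g)" "permutation (residue_map n f)"
    using residue_map_permutes assms permutation_permutes by blast+
  ultimately show ?thesis by (simp add: residue_sign_def sign_compose)
qed

lemma shift_perm_maps: "(\<lambda>x. x + c) \<in> perm_maps n 1"
proof -
  have "x mod (int n + 1) = y mod (int n + 1)"
    if "(x + c) mod (int n + 1) = (y + c) mod (int n + 1)" for x y
    using that by (simp add: mod_eq_dvd_iff)
  moreover have "mono (\<lambda>x. x + c)" by (simp add: mono_def)
  moreover have "has_module n n (\<lambda>x. x + c) (int 1)" by (simp add: has_module_def)
  ultimately show ?thesis unfolding perm_maps_def by blast
qed

lemma residue_sign_cong:
  assumes "\<And>x. f x mod (int n + 1) = g x mod (int n + 1)"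
  shows "residue_sign n f = residue_sign n g"
  unfolding residue_sign_def residue_map_def assms by simp

section \<open>The two generating sums in terms of maps\<close>

lemma aut_alt_sum_eq:
  "aut_alt_sum n = (\<Sum>c\<in>{0..int n}.
     frag_cmul (residue_sign n (\<lambda>x. x + c)) (frag_of (epi_class n n (\<lambda>x. x + c))))"
proof -
  \<comment> \<open>Injectivity is read off from the known number of automorphisms.\<close>
  have "card ((\<lambda>c. epi_class n n (\<lambda>x. x + c)) ` {0..int n}) = card {0..int n}"
    using card_cyc_aut[of n] unfolding cyc_aut_eq by simp
  then have inj: "inj_on (\<lambda>c. epi_class n n (\<lambda>x. x + c)) {0..int n}"
    by (rule eq_card_imp_inj_on[rotated]) simp
  have "aut_perm (epi_class n n (\<lambda>x. x + c)) = residue_map n (\<lambda>x. x + c)" for c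
    using aut_perm_class[OF epi_map_shift] by (auto simp: fun_eq_iff residue_map_def)
  then show ?thesis
    unfolding aut_alt_sum_def cyc_aut_eq residue_sign_def
    by (simp add: sum.reindex[OF inj])
qed

lemma tilde_map_restrict:
  assumes "f \<in> perm_maps n k"
  shows "tilde_map n k (restrict f {0..int n + 1}) = f"
proof
  fix x
  have "x mod (int n + 1) \<in> {0..int n + 1}"
    using pos_mod_bound[of "int n + 1" x] by simp
  then have "tilde_map n k (restrict f {0..int n + 1}) x
      = f (x mod (int n + 1)) + x div (int n + 1) * (int k * (int n + 1))"
    by (simp add: tilde_map_def)
  also have "\<dots> = f (x mod (int n + 1) + x div (int n + 1) * (int n + 1))"
    by (simp only: perm_maps_shift[OF assms])
  finally show "tilde_map n k (restrict f {0..int n + 1}) x = f x"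
    by (simp only: mod_div_mult_eq)
qed

lemma restrict_Sigma_set:
  assumes "f \<in> pointed_perm_maps n k"
  shows "restrict f {0..int n + 1} \<in> Sigma_set n k"
proof -
  have f: "f \<in> perm_maps n k" "f 0 = 0"
    using assms by (auto simp: pointed_perm_maps_def)
  have top: "f (int n + 1) = int k * (int n + 1)"
    using perm_maps_shift[OF f(1), of 0 1] f(2) by simp
  have mono: "mono f" by (rule perm_mapsD(1)[OF f(1)])
  have "f x \<in> {0..int k * (int n + 1)}" if "x \<in> {0..int n + 1}" for x
    using monoD[OF mono, of 0 x] monoD[OF mono, of x "int n + 1"] that f(2) top by simp
  moreover have "mono_on {0..int n + 1} (restrict f {0..int n + 1})"
    using mono by (auto simp: mono_on_def mono_def)
  moreover have "bij_betw (\<lambda>j. restrict f {0..int n + 1} j mod (int n + 1)) {0..int n} {0..int n}"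
    using perm_maps_residue_bij[OF f(1)]
    by (rule bij_betw_cong[THEN iffD1, rotated]) simp
  ultimately show ?thesis
    using f(2) top unfolding Sigma_set_def interval_hom_def by simp
qed

lemma tilde_map_pointed:
  assumes "\<alpha> \<in> Sigma_set n k" "k > 0"
  shows "tilde_map n k \<alpha> \<in> pointed_perm_maps n k"
proof -
  have bij: "bij_betw (\<lambda>j. \<alpha> j mod (int n + 1)) {0..int n} {0..int n}" and "\<alpha> 0 = 0"
    using assms unfolding Sigma_set_def interval_hom_def by auto
  have "x mod (int n + 1) = y mod (int n + 1)"
    if "tilde_map n k \<alpha> x mod (int n + 1) = tilde_map n k \<alpha> y mod (int n + 1)" for x y
  proof -
    have r: "z mod (int n + 1) \<in> {0..int n}" for z
      using pos_mod_bound[of "int n + 1" z] by simp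
    \<comment> \<open>The periodic correction is a multiple of \<open>n + 1\<close> and disappears
      modulo \<open>n + 1\<close>.\<close>
    have "tilde_map n k \<alpha> z mod (int n + 1) = \<alpha> (z mod (int n + 1)) mod (int n + 1)" for z
      unfolding tilde_map_def mult.assoc[symmetric] by simp
    then show ?thesis
      using that inj_onD[OF bij_betw_imp_inj_on[OF bij] _ r r, of x y] by simp
  qed
  moreover have "tilde_map n k \<alpha> 0 = 0"
    using \<open>\<alpha> 0 = 0\<close> by (simp add: tilde_map_def)
  ultimately show ?thesis
    using tilde_map_epi[OF assms]
    unfolding pointed_perm_maps_def perm_maps_def epi_map_def by blast
qed

text \<open>Since \<open>\<alpha> 0 = 0\<close>, adding the residue 0 to the domain only adds a
  fixed point.\<close>

lemma Sigma_perm_eq: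
  assumes "\<alpha> \<in> Sigma_set n k"
  shows "Sigma_perm n \<alpha> = residue_map n (tilde_map n k \<alpha>)"
proof
  fix j
  have "\<alpha> 0 = 0" using assms unfolding Sigma_set_def interval_hom_def by simp
  then show "Sigma_perm n \<alpha> j = residue_map n (tilde_map n k \<alpha>) j"
    using tilde_map_extends[OF assms, of j]
    by (cases "j = 0") (auto simp: Sigma_perm_def residue_map_def)
qed

lemma tilde_map_bij:
  assumes "k > 0"
  shows "bij_betw (tilde_map n k) (Sigma_set n k) (pointed_perm_maps n k)"
proof (rule bij_betw_byWitness[where f' = "\<lambda>f. restrict f {0..int n + 1}"])
  show "\<forall>\<alpha>\<in>Sigma_set n k. restrict (tilde_map n k \<alpha>) {0..int n + 1} = \<alpha>"
  proof
    fix \<alpha> assume \<alpha>: "\<alpha> \<in> Sigma_set n k"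
    \<comment> \<open>Extensionality makes restriction recover \<open>\<alpha>\<close> itself, not
      only its values on the interval.\<close>
    then have "\<alpha> \<in> extensional {0..int n + 1}"
      unfolding Sigma_set_def interval_hom_def by (simp add: PiE_def)
    then show "restrict (tilde_map n k \<alpha>) {0..int n + 1} = \<alpha>"
      using tilde_map_extends[OF \<alpha>] by (auto intro: extensionalityI)
  qed
qed (use assms tilde_map_restrict restrict_Sigma_set tilde_map_pointed
      in \<open>auto simp: pointed_perm_maps_def\<close>)

lemma finite_pointed_perm_maps: "k > 0 \<Longrightarrow> finite (pointed_perm_maps n k)"
  using bij_betw_finite[OF tilde_map_bij] finite_Sigma_set by blast

lemma Lam_eq:
  assumes "k > 0"
  shows "Lam n k = (\<Sum>f\<in>pointed_perm_maps n k.
     frag_cmul (residue_sign n f) (frag_of (epi_class n n f)))"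
  unfolding Lam_def
  by (subst sum.reindex_bij_betw[OF tilde_map_bij[OF assms, of n], symmetric])
    (simp add: residue_sign_def Sigma_perm_eq)

section \<open>Removing the multiples of \<open>n + 2\<close>\<close>

text \<open>The map \<open>B0_map n\<close> is the increasing enumeration of the integers that are not divisible by
  \<open>n + 2\<close>; its left inverse collapses each multiple \<open>j * (n + 2)\<close> with its predecessor.\<close>

definition collapse :: "nat \<Rightarrow> int \<Rightarrow> int" where
  "collapse n y = y - 1 - y div (int n + 2)"

lemma B0_map_alt: "B0_map n x = 1 + x + x div (int n + 1)"
  unfolding B0_map_def by (simp add: minus_div_mult_eq_mod[symmetric] algebra_simps)

lemma B0_map_mod: "B0_map n x mod (int n + 2) = x mod (int n + 1) + 1"
  using pos_mod_bound[of "int n + 1" x] unfolding B0_map_def by simp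

lemma B0_map_div: "B0_map n x div (int n + 2) = x div (int n + 1)"
  using pos_mod_bound[of "int n + 1" x] unfolding B0_map_def by simp

lemma collapse_B0_map [simp]: "collapse n (B0_map n x) = x"
  unfolding collapse_def B0_map_div by (simp add: B0_map_alt)

lemma collapse_eq:
  "collapse n y = (y mod (int n + 2) - 1) + (y div (int n + 2)) * (int n + 1)"
  unfolding collapse_def by (simp add: minus_div_mult_eq_mod[symmetric] algebra_simps)

lemma B0_map_collapse:
  assumes "y mod (int n + 2) \<noteq> 0"
  shows "B0_map n (collapse n y) = y"
proof -
  have "0 \<le> y mod (int n + 2) - 1" "y mod (int n + 2) - 1 \<le> int n"
    using assms pos_mod_bound[of "int n + 2" y] pos_mod_sign[of "int n + 2" y] by linarith+
  then show ?thesis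
    unfolding collapse_eq using mod_div_mult_eq[of y "int n + 2"] by (simp add: B0_map_eq)
qed

lemma collapse_mod:
  assumes "y mod (int n + 2) \<noteq> 0"
  shows "collapse n y mod (int n + 1) = y mod (int n + 2) - 1"
  using B0_map_mod[of n "collapse n y"] B0_map_collapse[OF assms] by simp

lemma collapse_shift: "collapse n (y + j * (int n + 2)) = collapse n y + j * (int n + 1)"
  unfolding collapse_def by (subst div_mult_self1) (simp_all add: algebra_simps)

lemma B0_map_shift: "B0_map n (x + j * (int n + 1)) = B0_map n x + j * (int n + 2)"
  unfolding B0_map_alt by (subst div_mult_self1) (simp_all add: algebra_simps)

lemma mono_int_iff:
  fixes f :: "int \<Rightarrow> int"
  shows "mono f \<longleftrightarrow> (\<forall>x. f x \<le> f (x + 1))"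
proof
  assume *: "\<forall>x. f x \<le> f (x + 1)"
  show "mono f"
  proof (rule monoI)
    fix x y :: int assume "x \<le> y"
    then show "f x \<le> f y"
    proof (induction y rule: int_ge_induct)
      case (step i) then show ?case using * by (meson order_trans)
    qed simp
  qed
qed (simp add: monoD)

lemma mono_B0_map: "mono (B0_map n)"
  using B0_map_epi(2) by (simp add: epi_map_def)

text \<open>When \<open>y\<close> grows by one, the subtracted quotient grows by at most
  one.\<close>

lemma mono_collapse: "mono (collapse n)"
proof -
  have "(y + 1) div (int n + 2) \<le> y div (int n + 2) + 1" for y
    using zdiv_mono1[of "y + 1" "y + (int n + 2)" "int n + 2"]
      div_add_self2[of "int n + 2" y] by simp
  then show ?thesis unfolding mono_int_iff collapse_def by (simp add: algebra_simps)
qed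

section \<open>From pointed maps modulo \<open>n + 2\<close> to maps modulo
  \<open>n + 1\<close>\<close>

lemma pointed_perm_maps_shift:
  assumes "h \<in> pointed_perm_maps (n + 1) k"
  shows "h (x + j * (int n + 2)) = h x + j * (int k * (int n + 2))"
proof -
  have "int (n + 1) + 1 = int n + 2" by simp
  then show ?thesis
    using perm_maps_shift[of h "n + 1" k x j] assms
    by (simp only: pointed_perm_maps_def mem_Collect_eq)
qed

lemma pointed_perm_maps_inj_mod:
  assumes "h \<in> pointed_perm_maps (n + 1) k" "h x mod (int n + 2) = h y mod (int n + 2)"
  shows "x mod (int n + 2) = y mod (int n + 2)"
proof -
  have "int (n + 1) + 1 = int n + 2" by simp
  then show ?thesis
    using perm_mapsD(3)[of h "n + 1" k x y] assms
    by (simp only: pointed_perm_maps_def mem_Collect_eq)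
qed

text \<open>The residue 0 is already taken by \<open>h 0 = 0\<close>.\<close>

lemma pointed_perm_maps_nonzero:
  assumes "h \<in> pointed_perm_maps (n + 1) k" "y mod (int n + 2) \<noteq> 0"
  shows "h y mod (int n + 2) \<noteq> 0"
  using pointed_perm_maps_inj_mod[OF assms(1), of y 0] assms
  by (auto simp: pointed_perm_maps_def)

lemma B0_map_nonzero: "B0_map n x mod (int n + 2) \<noteq> 0"
  using pos_mod_sign[of "int n + 1" x] unfolding B0_map_mod by linarith

lemma B0_map_collapse_pointed:
  assumes "h \<in> pointed_perm_maps (n + 1) k"
  shows "B0_map n (collapse n (h (B0_map n x))) = h (B0_map n x)"
  by (rule B0_map_collapse[OF pointed_perm_maps_nonzero[OF assms B0_map_nonzero]])

lemma collapse_conj_perm_maps: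
  assumes h: "h \<in> pointed_perm_maps (n + 1) k"
  shows "collapse n \<circ> h \<circ> B0_map n \<in> perm_maps n k"
proof -
  have "mono h" using h by (simp add: pointed_perm_maps_def perm_maps_def)
  then have "mono (collapse n \<circ> h \<circ> B0_map n)"
    using mono_collapse[of n] mono_B0_map[of n] by (simp add: mono_def)
  moreover have "has_module n n (collapse n \<circ> h \<circ> B0_map n) (int k)"
    unfolding has_module_def
  proof
    fix x
    have "h (B0_map n (x + (int n + 1))) = h (B0_map n x) + int k * (int n + 2)"
      using B0_map_shift[of n x 1] pointed_perm_maps_shift[OF h, of "B0_map n x" 1] by simp
    then show "(collapse n \<circ> h \<circ> B0_map n) (x + (int n + 1))
        = (collapse n \<circ> h \<circ> B0_map n) x + int k * (int n + 1)"
      by (simp add: collapse_shift)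
  qed
  moreover have "x mod (int n + 1) = y mod (int n + 1)"
    if "(collapse n \<circ> h \<circ> B0_map n) x mod (int n + 1)
      = (collapse n \<circ> h \<circ> B0_map n) y mod (int n + 1)" for x y
  proof -
    \<comment> \<open>Away from multiples of \<open>n + 2\<close>, \<open>collapse\<close> just
      lowers the residue by one, so no two residues are merged.\<close>
    have "h (B0_map n x) mod (int n + 2) = h (B0_map n y) mod (int n + 2)"
      using that collapse_mod[OF pointed_perm_maps_nonzero[OF h B0_map_nonzero]] by simp
    then show ?thesis
      using pointed_perm_maps_inj_mod[OF h] B0_map_mod by (metis add_right_cancel)
  qed
  ultimately show ?thesis unfolding perm_maps_def by blast
qed

text \<open>\<open>h\<close> fixes the residue 0, and on \<open>1, ..., n + 1\<close> it acts as the
  conjugate acts on \<open>0, ..., n\<close>, relabelled by \<open>j + 1\<close>. Neither the fixed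
  point nor the relabelling changes the sign.\<close>

lemma residue_sign_collapse_conj:
  assumes h: "h \<in> pointed_perm_maps (n + 1) k"
  shows "residue_sign n (collapse n \<circ> h \<circ> B0_map n) = residue_sign (n + 1) h"
proof -
  let ?f = "collapse n \<circ> h \<circ> B0_map n"
  let ?s = "\<lambda>j::int. j + 1"
  have perm: "residue_map n ?f permutes {0..int n}"
    by (rule residue_map_permutes[OF collapse_conj_perm_maps[OF h]])
  have img: "?s ` {0..int n} = {1..int n + 1}" by (simp add: add.commute)
  have "residue_map (n + 1) h = map_permutation {0..int n} ?s (residue_map n ?f)"
  proof
    fix y
    have h0: "h 0 = 0" using h by (simp add: pointed_perm_maps_def)
    consider "y \<in> {1..int n + 1}" | "y = 0" | "y \<notin> {0..int n + 1}" by fastforce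
    then show "residue_map (n + 1) h y = map_permutation {0..int n} ?s (residue_map n ?f) y"
    proof cases
      case 1
      define x where "x = y - 1"
      have x: "x \<in> {0..int n}" "y = x + 1" using 1 by (auto simp: x_def)
      have B: "B0_map n x = y" using B0_map_eq[of x n 0] x by simp
      have "map_permutation {0..int n} ?s (residue_map n ?f) y = residue_map n ?f x + 1"
        unfolding x(2) using x(1) by (subst map_permutation_apply) (auto intro: inj_onI)
      also have "\<dots> = h y mod (int n + 2)"
        using x(1) B collapse_mod[OF pointed_perm_maps_nonzero[OF h B0_map_nonzero], of x]
        by (simp add: residue_map_def)
      also have "\<dots> = residue_map (n + 1) h y"
        using 1 by (simp add: residue_map_def add.commute)
      finally show ?thesis by simp
    next
      case 2
      then show ?thesis unfolding map_permutation_def img by (simp add: residue_map_def h0)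
    next
      case 3
      then show ?thesis unfolding map_permutation_def img by (auto simp: residue_map_def)
    qed
  qed
  then show ?thesis
    unfolding residue_sign_def using sign_map_permutation[of ?s "{0..int n}"] perm
    by (simp add: inj_on_def)
qed

section \<open>The inverse construction: restoring the multiples of \<open>n + 2\<close>\<close>

text \<open>A map of module \<open>k\<close> with value 0 at 0 must send \<open>j * (n + 2)\<close>
  to \<open>k * j * (n + 2)\<close>; this forces the value \<open>k * y\<close>. All other
  \<open>y\<close> lie in the image of \<open>B0_map\<close>.\<close>

definition insert_zero :: "nat \<Rightarrow> nat \<Rightarrow> (int \<Rightarrow> int) \<Rightarrow> int \<Rightarrow> int" where
  "insert_zero n k f y =
     (if y mod (int n + 2) = 0 then int k * y else B0_map n (f (collapse n y)))"

lemma insert_zero_B0_map: "insert_zero n k f (B0_map n x) = B0_map n (f x)"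
  by (simp add: insert_zero_def B0_map_nonzero)

lemma insert_zero_shift:
  assumes "f \<in> perm_maps n k"
  shows "insert_zero n k f (y + j * (int n + 2)) = insert_zero n k f y + j * (int k * (int n + 2))"
proof -
  have "B0_map n (f (collapse n (y + j * (int n + 2))))
      = B0_map n (f (collapse n y)) + j * (int k * (int n + 2))"
    using B0_map_shift[of n _ "j * int k"]
    by (simp only: collapse_shift perm_maps_shift[OF assms] mult.assoc)
  moreover have "(y + j * (int n + 2)) mod (int n + 2) = y mod (int n + 2)"
    by (rule mod_mult_self1)
  moreover have "int k * (y + j * (int n + 2)) = int k * y + j * (int k * (int n + 2))"
    by (simp add: algebra_simps)
  ultimately show ?thesis by (simp add: insert_zero_def)
qed

text \<open>Only steps into or out of a multiple of \<open>n + 2\<close> are in doubt, and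
  periodicity moves them to 0. There the sign change of \<open>f\<close> between -1 and 0 places the
  inserted value 0 correctly.\<close>

lemma insert_zero_mono:
  assumes f: "f \<in> perm_maps n k" "f (- 1) < 0" "f 0 \<ge> 0"
  shows "mono (insert_zero n k f)"
  unfolding mono_int_iff
proof
  fix y
  let ?h = "insert_zero n k f"
  have h0: "?h 0 = 0" by (simp add: insert_zero_def)
  have h1: "?h 1 \<ge> 0"
    using insert_zero_B0_map[of n k f 0] monoD[OF mono_B0_map f(3), of n]
    by (simp add: B0_map_def)
  have "B0_map n (- 1) = - 1" by (simp add: B0_map_alt div_eq_minus1)
  then have hm1: "?h (- 1) \<le> 0"
    using insert_zero_B0_map[of n k f "- 1"] monoD[OF mono_B0_map, of "f (- 1)" "- 1" n] f(2)
    by simp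
  show "?h y \<le> ?h (y + 1)"
  proof (cases "y mod (int n + 2) = 0 \<or> (y + 1) mod (int n + 2) = 0")
    case True
    then obtain j where "y = j * (int n + 2) \<or> y + 1 = j * (int n + 2)"
      by (metis dvd_def mod_eq_0_iff_dvd mult.commute)
    then have "y = 0 + j * (int n + 2) \<or> y = - 1 + j * (int n + 2)"
      by linarith
    then show ?thesis
    proof
      assume y: "y = 0 + j * (int n + 2)"
      then have "y + 1 = 1 + j * (int n + 2)" by simp
      then show ?thesis 
        using insert_zero_shift[OF f(1), of 0 j] insert_zero_shift[OF f(1), of 1 j] h0 h1 y
        by (simp add: add.commute)
    next
      assume y: "y = - 1 + j * (int n + 2)"
      then have "y + 1 = 0 + j * (int n + 2)" by simp
      then show ?thesis 
        using insert_zero_shift[OF f(1), of 0 j] insert_zero_shift[OF f(1), of "- 1" j] h0 hm1 y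
        by simp
    qed
  next
    case False
    have "f (collapse n y) \<le> f (collapse n (y + 1))"
      using perm_mapsD(1)[OF f(1)] mono_collapse[of n] by (simp add: mono_def)
    then show ?thesis
      using False monoD[OF mono_B0_map] by (simp add: insert_zero_def)
  qed
qed

lemma insert_zero_pointed:
  assumes f: "f \<in> perm_maps n k" "f (- 1) < 0" "f 0 \<ge> 0"
  shows "insert_zero n k f \<in> pointed_perm_maps (n + 1) k"
proof -
  let ?h = "insert_zero n k f"
  have N: "int (n + 1) + 1 = int n + 2" by simp
  have "has_module (n + 1) (n + 1) ?h (int k)"
    unfolding has_module_def N using insert_zero_shift[OF f(1), of _ 1] by simp
  moreover have "x mod (int n + 2) = y mod (int n + 2)"
    if eq: "?h x mod (int n + 2) = ?h y mod (int n + 2)" for x y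
  proof -
    \<comment> \<open>Inserted values are multiples of \<open>n + 2\<close> and values of
      \<open>B0_map\<close> never are, so the two branches cannot collide modulo
      \<open>n + 2\<close>.\<close>
    have zero: "?h z mod (int n + 2) = 0 \<longleftrightarrow> z mod (int n + 2) = 0" for z
      using B0_map_nonzero[of n] by (auto simp: insert_zero_def)
    show ?thesis
    proof (cases "x mod (int n + 2) = 0")
      case True
      then show ?thesis using zero eq by metis
    next
      case False
      then have nz: "x mod (int n + 2) \<noteq> 0" "y mod (int n + 2) \<noteq> 0" using zero eq by metis+
      then have "f (collapse n x) mod (int n + 1) = f (collapse n y) mod (int n + 1)"
        using eq by (simp add: insert_zero_def B0_map_mod)
      then have "collapse n x mod (int n + 1) = collapse n y mod (int n + 1)"
        by (rule perm_mapsD(3)[OF f(1)])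
      then show ?thesis using nz by (simp add: collapse_mod)
    qed
  qed
  moreover have "?h 0 = 0" by (simp add: insert_zero_def)
  ultimately show ?thesis
    using insert_zero_mono[OF f] unfolding pointed_perm_maps_def perm_maps_def N by blast
qed

section \<open>Two parametrisations of the maps in a fundamental domain\<close>

text \<open>Precomposing \<open>f\<close> with translation by \<open>n + 1\<close> adds
  \<open>k * (n + 1)\<close> to it. For \<open>k > 0\<close> the bounds thus select one map from
  each orbit of this translation.\<close>

definition domain_perm_maps :: "nat \<Rightarrow> nat \<Rightarrow> (int \<Rightarrow> int) set" where
  "domain_perm_maps n k = {f \<in> perm_maps n k. 0 \<le> f 0 \<and> f 0 < int k * (int n + 1)}"

text \<open>Division of \<open>f 0\<close> by \<open>n + 1\<close> gives remainder \<open>c\<close>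
  and quotient \<open>a\<close>: \<open>c\<close> will be the rotation in \<open>A\<close>, and
  \<open>a\<close> accounts for the factor \<open>k\<close>.\<close>

lemma domain_perm_maps_bij_translate:
  "bij_betw (\<lambda>(f, c, a) x. f x + c + a * (int n + 1))
     (pointed_perm_maps n k \<times> {0..int n} \<times> {0..<int k}) (domain_perm_maps n k)"
proof (rule bij_betw_byWitness
    [where f' = "\<lambda>f. (\<lambda>x. f x - f 0, f 0 mod (int n + 1), f 0 div (int n + 1))"])
  have trans: "(\<lambda>x. f x + b) \<in> perm_maps n k" if "f \<in> perm_maps n k" for f b
    using perm_maps_comp[OF that shift_perm_maps[of b]] by (simp add: comp_def)
  show "(\<lambda>(f, c, a) x. f x + c + a * (int n + 1)) `
      (pointed_perm_maps n k \<times> {0..int n} \<times> {0..<int k}) \<subseteq> domain_perm_maps n k"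
  proof clarify
    fix f c a assume f: "f \<in> pointed_perm_maps n k" "c \<in> {0..int n}" "a \<in> {0..<int k}"
    \<comment> \<open>Together with \<open>c < n + 1\<close> this keeps
      \<open>c + a * (n + 1)\<close> below \<open>k * (n + 1)\<close>.\<close>
    have "(a + 1) * (int n + 1) \<le> int k * (int n + 1)"
      using f(3) by (intro mult_right_mono) auto
    then show "(\<lambda>x. f x + c + a * (int n + 1)) \<in> domain_perm_maps n k"
      using trans[of f "c + a * (int n + 1)"] f
      by (auto simp: domain_perm_maps_def pointed_perm_maps_def add.assoc algebra_simps)
  qed
  show "(\<lambda>f. (\<lambda>x. f x - f 0, f 0 mod (int n + 1), f 0 div (int n + 1))) ` domain_perm_maps n k
      \<subseteq> pointed_perm_maps n k \<times> {0..int n} \<times> {0..<int k}"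
  proof (rule image_subsetI)
    fix f assume f: "f \<in> domain_perm_maps n k"
    have "f 0 div (int n + 1) * (int n + 1) < int k * (int n + 1)"
      using f mod_div_mult_eq[of "f 0" "int n + 1"] pos_mod_sign[of "int n + 1" "f 0"]
      unfolding domain_perm_maps_def mem_Collect_eq by linarith
    then have "f 0 div (int n + 1) < int k" by (rule mult_right_less_imp_less) simp
    moreover have "0 \<le> f 0 div (int n + 1)"
      using f by (simp add: domain_perm_maps_def pos_imp_zdiv_nonneg_iff)
    moreover have "f 0 mod (int n + 1) \<in> {0..int n}"
      using pos_mod_bound[of "int n + 1" "f 0"] by simp
    moreover have "(\<lambda>x. f x - f 0) \<in> pointed_perm_maps n k"
      using trans[of f "- f 0"] f by (simp add: domain_perm_maps_def pointed_perm_maps_def)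
    ultimately show "(\<lambda>x. f x - f 0, f 0 mod (int n + 1), f 0 div (int n + 1))
        \<in> pointed_perm_maps n k \<times> {0..int n} \<times> {0..<int k}"
      by (simp only: mem_Times_iff fst_conv snd_conv atLeastLessThan_iff simp_thms)
  qed
  show "\<forall>f\<in>domain_perm_maps n k. (\<lambda>(f, c, a) x. f x + c + a * (int n + 1))
      (\<lambda>x. f x - f 0, f 0 mod (int n + 1), f 0 div (int n + 1)) = f"
    by (simp only: split_conv add.assoc mod_div_mult_eq diff_add_cancel ball_triv simp_thms)
  show "\<forall>z\<in>pointed_perm_maps n k \<times> {0..int n} \<times> {0..<int k}.
      (\<lambda>f. (\<lambda>x. f x - f 0, f 0 mod (int n + 1), f 0 div (int n + 1)))
        ((\<lambda>(f, c, a) x. f x + c + a * (int n + 1)) z) = z"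
  proof (rule ballI)
    fix z assume "z \<in> pointed_perm_maps n k \<times> {0..int n} \<times> {0..<int k}"
    then obtain f c a where z: "z = (f, c, a)" "f 0 = 0" "c \<in> {0..int n}"
      by (auto simp: pointed_perm_maps_def)
    have "(c + a * (int n + 1)) mod (int n + 1) = c" "(c + a * (int n + 1)) div (int n + 1) = a"
      using z(3) by simp_all
    then show "(\<lambda>f. (\<lambda>x. f x - f 0, f 0 mod (int n + 1), f 0 div (int n + 1)))
        ((\<lambda>(f, c, a) x. f x + c + a * (int n + 1)) z) = z"
      by (simp only: z(1,2) split_conv add_0_left add.assoc add_diff_cancel_right')
  qed
qed

text \<open>The conjugate of \<open>h\<close> is negative at -1 and non-negative at 0. After the
  shift by \<open>d\<close> this change occurs between \<open>- 1 - d\<close> and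
  \<open>- d\<close>, so the resulting map determines \<open>d\<close>.\<close>

lemma domain_perm_maps_bij_conj:
  assumes "k > 0"
  shows "bij_betw (\<lambda>(h, d). collapse n \<circ> h \<circ> B0_map n \<circ> (\<lambda>x. x + d))
     (pointed_perm_maps (n + 1) k \<times> {0..int n}) (domain_perm_maps n k)"
    (is "bij_betw ?\<Phi> ?L ?R")
proof (rule bij_betw_imageI)
  have strict: "strict_mono h" if "h \<in> pointed_perm_maps (n + 1) k" for h
    using that perm_maps_strict_mono[of h "n + 1" k] by (simp add: pointed_perm_maps_def)
  have "d \<le> d'"
    if h: "h \<in> pointed_perm_maps (n + 1) k" "h' \<in> pointed_perm_maps (n + 1) k"
      and eq: "\<And>x. h (B0_map n (x + d)) = h' (B0_map n (x + d'))" for h h' d d'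
  proof (rule ccontr)
    assume "\<not> d \<le> d'"
    \<comment> \<open>The two sides are compared at \<open>x = - d' - 1\<close>: on the left
      \<open>h\<close> is applied to an argument at least 1 and is positive, on the right stands
      \<open>h' (- 1)\<close>, which is negative.\<close>
    then have "B0_map n 0 \<le> B0_map n (d - d' - 1)" by (intro monoD[OF mono_B0_map]) simp
    moreover have "B0_map n 0 = 1" by (simp add: B0_map_def)
    ultimately have "h 0 < h (B0_map n (d - d' - 1))"
      using strict_monoD[OF strict[OF h(1)]] by simp
    moreover have "B0_map n (- 1) = - 1" by (simp add: B0_map_alt div_eq_minus1)
    then have "h' (B0_map n (- 1)) < h' 0"
      using strict_monoD[OF strict[OF h(2)], of "- 1" 0] by simp
    ultimately show False
      using eq[of "- d' - 1"] h by (simp add: pointed_perm_maps_def algebra_simps)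
  qed
  note le = this
  show "inj_on ?\<Phi> ?L"
  proof (rule inj_onI, clarify)
    fix h d h' d'
    assume h: "h \<in> pointed_perm_maps (n + 1) k" "h' \<in> pointed_perm_maps (n + 1) k"
      and eq: "collapse n \<circ> h \<circ> B0_map n \<circ> (\<lambda>x. x + d) = collapse n \<circ> h' \<circ> B0_map n \<circ> (\<lambda>x. x + d')"
    have eq': "h (B0_map n (x + d)) = h' (B0_map n (x + d'))" for x
    proof -
      have "collapse n (h (B0_map n (x + d))) = collapse n (h' (B0_map n (x + d')))"
        using fun_cong[OF eq, of x] by simp
      then show ?thesis using B0_map_collapse_pointed h by metis
    qed
    have d: "d = d'" using le[OF h eq'] le[OF h(2,1) eq'[symmetric]] by simp
    \<comment> \<open>Multiples of \<open>n + 2\<close> are settled by the value at 0 and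
      periodicity, the remaining \<open>y\<close> by being values of \<open>B0_map\<close>.\<close>
    have "h y = h' y" for y
    proof (cases "y mod (int n + 2) = 0")
      case True
      then have "y = 0 + (y div (int n + 2)) * (int n + 2)"
        using mod_div_mult_eq[of y "int n + 2"] by simp
      then have val: "g y = g 0 + (y div (int n + 2)) * (int k * (int n + 2))"
        if "g \<in> pointed_perm_maps (n + 1) k" for g
        using pointed_perm_maps_shift[OF that] by metis
      then show ?thesis using val[OF h(1)] val[OF h(2)] h by (simp add: pointed_perm_maps_def)
    next
      case False
      then show ?thesis using eq'[of "collapse n y - d"] d by (simp add: B0_map_collapse)
    qed
    then show "h = h' \<and> d = d'" using d by auto
  qed
  show "?\<Phi> ` ?L = ?R"
  proof (intro equalityI subsetI)
    fix f assume "f \<in> ?\<Phi> ` ?L"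
    then obtain h d where h: "h \<in> pointed_perm_maps (n + 1) k" and d: "d \<in> {0..int n}"
      and f: "f = (collapse n \<circ> h \<circ> B0_map n) \<circ> (\<lambda>x. x + d)" by auto
    have "f \<in> perm_maps n k"
      using perm_maps_comp[OF shift_perm_maps collapse_conj_perm_maps[OF h]] by (simp add: f)
    have B: "B0_map n d = d + 1" using d B0_map_eq[of d n 0] by simp
    have "h 0 = 0" "h (int n + 2) = int k * (int n + 2)"
      using h pointed_perm_maps_shift[OF h, of 0 1] by (simp_all add: pointed_perm_maps_def)
    \<comment> \<open>As \<open>0 < d + 1 < n + 2\<close>, strictness gains one at both ends;
      \<open>collapse\<close> takes these bounds to 0 and \<open>k * (n + 1) - 1\<close>.\<close>
    then have "1 \<le> h (d + 1)" "h (d + 1) \<le> int k * (int n + 2) - 1"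
      using strict_monoD[OF strict[OF h], of 0 "d + 1"]
        strict_monoD[OF strict[OF h], of "d + 1" "int n + 2"] d by simp_all
    then have "collapse n 1 \<le> f 0" "f 0 \<le> collapse n (- 1 + int k * (int n + 2))"
      using monoD[OF mono_collapse[of n]] by (simp_all add: f B)
    moreover have "collapse n 1 = 0" "collapse n (- 1) = - 1"
      by (simp_all add: collapse_def div_eq_minus1)
    ultimately show "f \<in> ?R"
      using \<open>f \<in> perm_maps n k\<close> unfolding domain_perm_maps_def collapse_shift by simp
  next
    fix f assume f: "f \<in> ?R"
    \<comment> \<open>Going left from 0, \<open>d\<close> locates the first negative value. One
      period back, at \<open>- 1 - n\<close>, the value is \<open>f 0 - k * (n + 1) < 0\<close>,
      hence \<open>d \<le> n\<close>; minimality gives \<open>f (- d) \<ge> 0\<close>.\<close>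
    define d where "d = (LEAST d::nat. f (- 1 - int d) < 0)"
    have *: "f (- 1 - int n) < 0"
      using f perm_maps_shift[of f n k 0 "- 1"]
      by (simp add: domain_perm_maps_def algebra_simps)
    have d: "d \<le> n" "f (- 1 - int d) < 0"
      unfolding d_def using Least_le[of "\<lambda>d. f (- 1 - int d) < 0", OF *]
        LeastI[of "\<lambda>d. f (- 1 - int d) < 0", OF *] by simp_all
    have "f (- int d) \<ge> 0"
    proof (cases d)
      case 0
      then show ?thesis using f by (simp add: domain_perm_maps_def)
    next
      case (Suc e)
      then have "\<not> f (- 1 - int e) < 0"
        using not_less_Least[of e "\<lambda>d. f (- 1 - int d) < 0"] by (simp add: d_def)
      then show ?thesis using Suc by (simp add: algebra_simps)
    qed
    \<comment> \<open>The shift moves the sign change to between -1 and 0, as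
      \<open>insert_zero\<close> requires.\<close>
    moreover define g where "g = f \<circ> (\<lambda>x. x + (- int d))"
    have "g \<in> perm_maps n k"
      using f perm_maps_comp[OF shift_perm_maps[of "- int d"], of f n k]
      unfolding g_def domain_perm_maps_def mem_Collect_eq mult_1 by blast
    ultimately have h: "insert_zero n k g \<in> pointed_perm_maps (n + 1) k"
      using d(2) by (intro insert_zero_pointed) (simp_all add: g_def)
    have "f = ?\<Phi> (insert_zero n k g, int d)"
      by (simp add: fun_eq_iff insert_zero_B0_map g_def)
    then show "f \<in> ?\<Phi> ` ?L"
      using h d(1) by (intro image_eqI[of _ _ "(insert_zero n k g, int d)"]) simp_all
  qed
qed

section \<open>The commutation relation\<close>

lemma epi_class_translate:
  assumes "epi_map n m f"
  shows "epi_class n m (\<lambda>x. f x + a * (int m + 1)) = epi_class n m f"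
proof -
  have "epi_map n m (\<lambda>x. f x + a * (int m + 1))"
    using epi_map_comp[OF assms epi_map_shift[of m "a * (int m + 1)"]] by (simp add: comp_def)
  from epi_class_eq_iff[OF assms this] show ?thesis by auto
qed

text \<open>The common summand to which both sides of the relation are reduced.\<close>

definition B0_term :: "nat \<Rightarrow> (int \<Rightarrow> int) \<Rightarrow> epi_ring" where
  "B0_term n f = frag_cmul (residue_sign n f) (frag_of (epi_class n (n + 1) (B0_map n \<circ> f)))"

lemma B_eq:
  "B n = (\<Sum>d\<in>{0..int n}. B0_term n (\<lambda>x. x + d))"
  unfolding B_def B0_def aut_alt_sum_eq B0_term_def
  by (simp only: epi_mult_sum_right[OF finite_atLeastAtMost_int] epi_mult_cmul_right
      epi_mult_of_class[OF epi_map_shift B0_map_epi(2)])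

lemma Lam_B:
  assumes "k > 0"
  shows "Lam (n + 1) k \<odot> B n = sum (B0_term n) (domain_perm_maps n k)"
proof -
  have summand: "frag_cmul (residue_sign (n + 1) h) (frag_of (epi_class (n + 1) (n + 1) h))
        \<odot> B0_term n (\<lambda>x. x + d)
      = B0_term n (collapse n \<circ> h \<circ> B0_map n \<circ> (\<lambda>x. x + d))"
    if h: "h \<in> pointed_perm_maps (n + 1) k" for h d
  proof -
    have "epi_map (n + 1) (n + 1) h"
      using h assms perm_maps_epi[of h "n + 1" k] unfolding pointed_perm_maps_def by simp
    moreover have "epi_map n (n + 1) (B0_map n \<circ> (\<lambda>x. x + d))"
      by (rule epi_map_comp[OF epi_map_shift B0_map_epi(2)])
    \<comment> \<open>\<open>B0_map\<close> undoes \<open>collapse\<close> here because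
      \<open>h\<close> takes no multiple of \<open>n + 2\<close> as a value on the image of
      \<open>B0_map\<close>.\<close>
    moreover have "B0_map n \<circ> (collapse n \<circ> h \<circ> B0_map n \<circ> (\<lambda>x. x + d))
        = h \<circ> (B0_map n \<circ> (\<lambda>x. x + d))"
      using B0_map_collapse_pointed[OF h] by (simp add: fun_eq_iff)
    ultimately show ?thesis
      using residue_sign_comp[OF shift_perm_maps collapse_conj_perm_maps[OF h]]
        residue_sign_collapse_conj[OF h]
      unfolding B0_term_def
      by (simp only: epi_mult_cmul_left epi_mult_cmul_right epi_mult_of_class frag_cmul_cmul
          mult.commute)
  qed
  have "Lam (n + 1) k \<odot> B n = (\<Sum>h\<in>pointed_perm_maps (n + 1) k. \<Sum>d\<in>{0..int n}.
      B0_term n (collapse n \<circ> h \<circ> B0_map n \<circ> (\<lambda>x. x + d)))"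
    unfolding Lam_eq[OF assms] B_eq
    by (simp only: epi_mult_sum_left[OF finite_pointed_perm_maps[OF assms]]
        epi_mult_sum_right[OF finite_atLeastAtMost_int] summand cong: sum.cong)
      (rule sum.swap)
  also have "\<dots> = (\<Sum>z\<in>pointed_perm_maps (n + 1) k \<times> {0..int n}.
      B0_term n ((\<lambda>(h, d). collapse n \<circ> h \<circ> B0_map n \<circ> (\<lambda>x. x + d)) z))"
    by (simp add: sum.cartesian_product case_prod_unfold)
  also have "\<dots> = sum (B0_term n) (domain_perm_maps n k)"
    by (rule sum.reindex_bij_betw[OF domain_perm_maps_bij_conj[OF assms]])
  finally show ?thesis .
qed

text \<open>In the domain sum, \<open>B0_map\<close> turns the translation by
  \<open>a * (n + 1)\<close> into one by \<open>a * (n + 2)\<close>, which changes neither class nor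
  sign. The sum over \<open>a\<close> therefore consists of \<open>k\<close> equal terms.\<close>

lemma B_Lam:
  assumes "k > 0"
  shows "frag_cmul (int k) (B n \<odot> Lam n k) = sum (B0_term n) (domain_perm_maps n k)"
proof -
  have translate: "B0_term n (\<lambda>x. f x + c + a * (int n + 1)) = B0_term n (\<lambda>x. f x + c)"
    if f: "f \<in> perm_maps n k" for f c a
  proof -
    have sgn: "residue_sign n (\<lambda>x. f x + c + a * (int n + 1)) = residue_sign n (\<lambda>x. f x + c)"
      by (rule residue_sign_cong) simp
    have "epi_map n (n + 1) (B0_map n \<circ> (\<lambda>x. f x + c))"
      using epi_map_comp[OF epi_map_comp[OF perm_maps_epi[OF f assms] epi_map_shift] B0_map_epi(2)]
      by (simp add: comp_def)
    moreover have "B0_map n (f x + c + a * (int n + 1))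
        = B0_map n (f x + c) + a * (int (n + 1) + 1)" for x
      using B0_map_shift[of n "f x + c" a] by simp
    ultimately have "epi_class n (n + 1) (B0_map n \<circ> (\<lambda>x. f x + c + a * (int n + 1)))
        = epi_class n (n + 1) (B0_map n \<circ> (\<lambda>x. f x + c))"
      using epi_class_translate[of n "n + 1" "B0_map n \<circ> (\<lambda>x. f x + c)" a]
      by (simp only: comp_def)
    then show ?thesis unfolding B0_term_def sgn by simp
  qed
  have summand: "B0_term n (\<lambda>x. x + c) \<odot> frag_cmul (residue_sign n f) (frag_of (epi_class n n f))
      = B0_term n (\<lambda>x. f x + c)" if "f \<in> pointed_perm_maps n k" for f c
  proof -
    have f: "f \<in> perm_maps n k" using that by (simp add: pointed_perm_maps_def)
    have "epi_map n (n + 1) (B0_map n \<circ> (\<lambda>x. x + c))"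
      by (rule epi_map_comp[OF epi_map_shift B0_map_epi(2)])
    then show ?thesis
      using residue_sign_comp[OF f shift_perm_maps[of c]]
      by (simp add: B0_term_def epi_mult_cmul_left epi_mult_cmul_right
          epi_mult_of_class[OF perm_maps_epi[OF f assms]] comp_def mult.commute)
  qed
  have "sum (B0_term n) (domain_perm_maps n k)
      = (\<Sum>z\<in>pointed_perm_maps n k \<times> {0..int n} \<times> {0..<int k}.
          B0_term n ((\<lambda>(f, c, a) x. f x + c + a * (int n + 1)) z))"
    by (rule sum.reindex_bij_betw[OF domain_perm_maps_bij_translate, symmetric])
  also have "\<dots> = (\<Sum>f\<in>pointed_perm_maps n k. \<Sum>c\<in>{0..int n}. \<Sum>a\<in>{0..<int k}.
      B0_term n (\<lambda>x. f x + c + a * (int n + 1)))"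
    by (simp add: sum.cartesian_product case_prod_unfold)
  also have "\<dots> = (\<Sum>f\<in>pointed_perm_maps n k. \<Sum>c\<in>{0..int n}.
      frag_cmul (int k) (B0_term n (\<lambda>x. f x + c)))"
  proof (intro sum.cong refl)
    fix f c assume "f \<in> pointed_perm_maps n k"
    moreover have "(\<Sum>a\<in>{0..<int k}. X) = frag_cmul (int k) X" for X :: epi_ring
    proof -
      have "(\<Sum>a\<in>I. X) = frag_cmul (int (card I)) X" if "finite I" for I :: "int set"
        using that by (induction I rule: finite_induct) (simp_all add: frag_cmul_distrib)
      then show ?thesis by simp
    qed
    ultimately show "(\<Sum>a\<in>{0..<int k}. B0_term n (\<lambda>x. f x + c + a * (int n + 1)))
        = frag_cmul (int k) (B0_term n (\<lambda>x. f x + c))"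
      by (simp add: translate pointed_perm_maps_def)
  qed
  also have "\<dots> = frag_cmul (int k) (B n \<odot> Lam n k)"
    unfolding Lam_eq[OF assms] B_eq
    by (simp only: epi_mult_sum_right[OF finite_pointed_perm_maps[OF assms]]
        epi_mult_sum_left[OF finite_atLeastAtMost_int] summand frag_cmul_sum cong: sum.cong)
  finally show ?thesis by simp
qed

theorem theoremB5:
  fixes n k :: nat
  assumes "n \<ge> 1" and "k \<ge> 1"
  shows "Lam (n + 1) k \<odot> B n = frag_cmul (int k) (B n \<odot> Lam n k)"
  using assms(2) by (simp only: Lam_B B_Lam)

end
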